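(* A point $x^*\in\mathbb R^n$ is weakly Pareto optimal for the problem of minimizing $F$ over $\Omega$ if and only if $x^*\in\Omega$ and $U(x^* )=0$, where the objective gap function $U:\mathbb R^n\to\mathbb R\cup\{+\infty\}$ is defined by $$U(x):=\sup_{z\in\Omega}\min_{1\le j\le m}[f_j(x)-f_j(z)].$$
   Context: Let $m,n,r\ge 1$, $A\in\mathbb R^{r\times n}$, $b\in\mathbb R^r$, and assume $\Omega:=\{x\in\mathbb R^n: Ax=b\}\neq\emptyset$. For $1\le j\le m$ let $f_j:\mathbb R^n\to\mathbb R$ be a $C^1$ function whose gradient is $L_j$-Lipschitz and which satisfies $f_j(y)-f_j(x)-\langle\nabla f_j(x),y-x\rangle\ge\frac{\mu_j}{2}\|x-y\|^2$ for all $x,y$, where $0\le\mu_j\le L_j<\infty$. Put $F:=(f_1,\dots,f_m)^\top$. A point $x^*$ is weakly Pareto optimal if $x^*\in\Omega$ and there is no $x\in\Omega$ with $f_j(x)<f_j(x^* )$ for all $j$. *)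

theory Defs
  imports "HOL-Analysis.Analysis"
begin

definition feasible_set :: "real ^ 'n ^ 'r \<Rightarrow> real ^ 'r \<Rightarrow> (real ^ 'n) set" where
  "feasible_set A b = {x. A *v x = b}"

definition weakly_Pareto_optimal ::
  "('m \<Rightarrow> 'a \<Rightarrow> real) \<Rightarrow> 'a set \<Rightarrow> 'a \<Rightarrow> bool" where
  "weakly_Pareto_optimal f \<Omega> x \<longleftrightarrow> x \<in> \<Omega> \<and> \<not> (\<exists>y\<in>\<Omega>. \<forall>j. f j y < f j x)"

(* Values in ereal: the supremum may be infinite. It never equals -\<infinity> when \<Omega> is nonempty. *)
definition objective_gap ::
  "('m::finite \<Rightarrow> 'a \<Rightarrow> real) \<Rightarrow> 'a set \<Rightarrow> 'a \<Rightarrow> ereal" where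
  "objective_gap f \<Omega> x = (SUP z\<in>\<Omega>. ereal (MIN j. f j x - f j z))"

end

theory Submission
  imports Defs
begin

text \<open>At a feasible \<open>x\<close> the choice z = \<open>x\<close> contributes 0 to the
  supremum, so the gap is nonnegative there (\<open>objective_gap_nonneg\<close>). It is positive
  exactly when some z in \<open>\<Omega>\<close> makes the minimum positive, that is, when z
  strictly improves all objectives at once (\<open>objective_gap_nonpos_iff\<close>). Hence the gap
  vanishes at a feasible point iff no such z exists.\<close>

lemma objective_gap_nonneg:
  assumes "x \<in> \<Omega>"
  shows "0 \<le> objective_gap f \<Omega> x"
proof -
  have "ereal (MIN j. f j x - f j x) \<le> objective_gap f \<Omega> x"
    unfolding objective_gap_def by (rule SUP_upper[OF assms])
  then show ?thesis
    by (simp add: zero_ereal_def)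
qed

text \<open>A supremum is \<le> 0 iff each of its terms is, so the claim reduces to a single
  competitor \<open>y\<close>, whether or not the supremum is attained or finite.\<close>

lemma objective_gap_nonpos_iff:
  "objective_gap f \<Omega> x \<le> 0 \<longleftrightarrow> \<not> (\<exists>y\<in>\<Omega>. \<forall>j. f j y < f j x)"
proof -
  \<comment> \<open>The index type is finite, so the minimum is attained: it is \<le> 0 iff some
    objective does not strictly decrease from \<open>x\<close> to \<open>y\<close>.\<close>
  have "(MIN j. f j x - f j y) \<le> 0 \<longleftrightarrow> \<not> (\<forall>j. f j y < f j x)" for y
    by (auto simp: Min_le_iff not_less)
  then show ?thesis
    by (simp add: objective_gap_def SUP_le_iff)
qed

lemma weakly_Pareto_optimal_iff_objective_gap:
  "weakly_Pareto_optimal f \<Omega> x \<longleftrightarrow> x \<in> \<Omega> \<and> objective_gap f \<Omega> x = 0"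
  using objective_gap_nonneg[of x \<Omega> f] objective_gap_nonpos_iff[of f \<Omega> x]
  by (auto simp: weakly_Pareto_optimal_def)

theorem lemma2p3:
  fixes A :: "real ^ 'n ^ 'r" and b :: "real ^ 'r"
    and f :: "'m::finite \<Rightarrow> real ^ 'n \<Rightarrow> real"
    and grad :: "'m \<Rightarrow> real ^ 'n \<Rightarrow> real ^ 'n"
    and L \<mu> :: "'m \<Rightarrow> real"
    and xs :: "real ^ 'n"
  assumes "feasible_set A b \<noteq> {}"
    and "\<And>j x. GDERIV (f j) x :> grad j x"
    and "\<And>j. continuous_on UNIV (grad j)"
    and "\<And>j. (L j)-lipschitz_on UNIV (grad j)"
    and "\<And>j. 0 \<le> \<mu> j" and "\<And>j. \<mu> j \<le> L j"
    and "\<And>j x y. f j y - f j x - grad j x \<bullet> (y - x) \<ge> \<mu> j / 2 * (norm (x - y))\<^sup>2"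
  shows "weakly_Pareto_optimal f (feasible_set A b) xs \<longleftrightarrow>
    xs \<in> feasible_set A b \<and> objective_gap f (feasible_set A b) xs = 0"
  by (rule weakly_Pareto_optimal_iff_objective_gap)

end
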